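(* For every $n\in\mathbb{N}^*$ and $k\in\{1,\ldots,n\}$, $$\big\vert NCPP_{k}(2n)\big\vert=C(n-1,n-k)=\frac{k}{n}\binom{2n-k-1}{n-1}.$$
   Context: For $n\in\mathbb{N}^*$, a pair partition of $\{1,\ldots,2n\}$ is a family of $n$ pairs $\{(l_h,r_h)\}_{h=1}^n$ with $\{l_h\}\cup\{r_h\}=\{1,\ldots,2n\}$, $l_h<r_h$ for all $h$, and $l_1<l_2<\cdots<l_n$; $PP(2n)$ denotes the set of all of them. It is non-crossing if for all $1\le h<k\le n$: $l_k<r_h$ if and only if $r_k<r_h$; $NCPP(2n)$ denotes the set of non-crossing pair partitions. For $k\in\{1,\ldots,n\}$, $NCPP_k(2n):=\{\{(l_h,r_h)\}_{h=1}^n\in NCPP(2n): 2n-l_n=k\}$. The Catalan's triangle is $C(0,0)=1$ and $C(n,k)=\frac{n+1-k}{n+1}\binom{n+k}{k}$ for $n\in\mathbb{N}^*$, $0\le k\le n$. *)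

theory Defs
  imports Complex_Main
begin

text \<open>
  A family \<open>{(l_h, r_h)}\<close> with \<open>h = 1, ..., n\<close> and increasing left entries is encoded as the list
  \<open>[(l_1, r_1), ..., (l_n, r_n)]\<close>; the pair with index \<open>h\<close> is the list entry at position \<open>h - 1\<close>.
  Distinctness of the \<open>2 n\<close> entries follows by counting from the covering condition.
\<close>

definition PP :: "nat \<Rightarrow> (nat \<times> nat) list set" where
  "PP n = {p. length p = n \<and>
              fst ` set p \<union> snd ` set p = {1..2 * n} \<and>
              (\<forall>h<n. fst (p ! h) < snd (p ! h)) \<and>
              (\<forall>h k. h < k \<longrightarrow> k < n \<longrightarrow> fst (p ! h) < fst (p ! k))}"

text \<open>\<open>PP n\<close> and \<open>NCPP n\<close> are the sets written \<open>PP(2n)\<close> and \<open>NCPP(2n)\<close> on paper.\<close>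

definition NCPP :: "nat \<Rightarrow> (nat \<times> nat) list set" where
  "NCPP n = {p \<in> PP n. \<forall>h k. h < k \<longrightarrow> k < n \<longrightarrow>
              (fst (p ! k) < snd (p ! h) \<longleftrightarrow> snd (p ! k) < snd (p ! h))}"

text \<open>For \<open>n \<ge> 1\<close>, \<open>fst (p ! (n - 1))\<close> is \<open>l_n\<close>; as \<open>l_n \<le> 2 n\<close>, the subtraction is exact.\<close>

definition NCPP_last :: "nat \<Rightarrow> nat \<Rightarrow> (nat \<times> nat) list set" where
  "NCPP_last k n = {p \<in> NCPP n. 2 * n - fst (p ! (n - 1)) = k}"

text \<open>Only meaningful for \<open>k \<le> n\<close>; values outside the triangle are irrelevant.\<close>

definition catalan_triangle :: "nat \<Rightarrow> nat \<Rightarrow> real" where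
  "catalan_triangle n k =
     (if n = 0 then 1
      else (real n + 1 - real k) / (real n + 1) * real ((n + k) choose k))"

end

theory Submission
  imports Defs
begin

text \<open>
  In a non-crossing pair partition all points after the last left entry \<open>l\<close> are right entries, so
  the last pair is \<open>(l, l + 1)\<close>. Deleting it gives a bijection onto the non-crossing pair partitions
  with one pair less whose left entries are all \<open>< l\<close>. Counting the latter by the bound on the left
  entries gives Pascal's recurrence, solved by a difference of two binomial coefficients.
\<close>

section \<open>Relabelling points to make room for an adjacent pair\<close>

definition shift :: "nat \<Rightarrow> nat \<Rightarrow> nat" where
  "shift l x = (if x < l then x else x + 2)"

definition insert_pair :: "nat \<Rightarrow> (nat \<times> nat) list \<Rightarrow> (nat \<times> nat) list" where
  "insert_pair l p = map (map_prod (shift l) (shift l)) p @ [(l, l + 1)]"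

definition NCPP_bounded :: "nat \<Rightarrow> nat \<Rightarrow> (nat \<times> nat) list set" where
  "NCPP_bounded n m = {p \<in> NCPP n. \<forall>a\<in>set p. fst a \<le> m}"

text \<open>Bundles the increase of left entries with the non-crossing condition, so that one
  \<open>sorted_wrt\<close> covers both quantifications over \<open>h < k\<close> and splits along
  \<open>@\<close>.\<close>

definition noncrossing :: "nat \<times> nat \<Rightarrow> nat \<times> nat \<Rightarrow> bool" where
  "noncrossing a b \<longleftrightarrow> fst a < fst b \<and> (fst b < snd a \<longleftrightarrow> snd b < snd a)"

lemma shift_less_iff [simp]: "shift l x < shift l y \<longleftrightarrow> x < y"
  by (auto simp: shift_def)

lemma inj_shift: "inj (shift l)"
  by (auto simp: inj_def shift_def split: if_splits)

lemma shift_less_pivot_iff [simp]: "shift l x < l \<longleftrightarrow> x < l"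
  by (auto simp: shift_def)

text \<open>The value \<open>Suc l\<close> is skipped by \<open>shift l\<close>. This is what keeps
  the pair \<open>(l, l + 1)\<close> from crossing any shifted pair.\<close>

lemma pivot_less_shift_iff: "l < shift l x \<longleftrightarrow> Suc l < shift l x"
  by (auto simp: shift_def)

lemma range_shift: "range (shift l) = - {l, l + 1}"
proof -
  have "x \<in> range (shift l)" if "x \<noteq> l" "x \<noteq> l + 1" for x
    using that by (intro image_eqI[of _ _ "if x < l then x else x - 2"]) (auto simp: shift_def)
  then show ?thesis by (auto simp: shift_def split: if_splits)
qed

lemma shift_image_interval:
  assumes "1 \<le> l" "l \<le> N + 1"
  shows "shift l ` {1..N} = {1..N + 2} - {l, l + 1}"
proof (rule set_eqI)
  fix x
  show "x \<in> shift l ` {1..N} \<longleftrightarrow> x \<in> {1..N + 2} - {l, l + 1}"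
  proof (cases "x \<in> range (shift l)")
    case True
    then obtain y where x: "x = shift l y" by blast
    have "x \<in> shift l ` {1..N} \<longleftrightarrow> y \<in> {1..N}"
      unfolding x by (rule inj_image_mem_iff[OF inj_shift])
    also have "\<dots> \<longleftrightarrow> x \<in> {1..N + 2} - {l, l + 1}"
      using assms by (auto simp: x shift_def)
    finally show ?thesis .
  next
    case False
    then have "x \<in> {l, l + 1}" unfolding range_shift by blast
    with False show ?thesis by blast
  qed
qed

section \<open>Inserting and deleting the last pair\<close>

lemma mem_NCPP_iff:
  "p \<in> NCPP n \<longleftrightarrow> length p = n \<and> fst ` set p \<union> snd ` set p = {1..2 * n} \<and>
     (\<forall>a\<in>set p. fst a < snd a) \<and> sorted_wrt noncrossing p"
  unfolding NCPP_def PP_def sorted_wrt_iff_nth_less noncrossing_def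
  by (simp only: mem_Collect_eq all_set_conv_all_nth) blast

lemma finite_NCPP: "finite (NCPP n)"
proof (rule finite_subset)
  show "NCPP n \<subseteq> {p. set p \<subseteq> {1..2 * n} \<times> {1..2 * n} \<and> length p = n}"
  proof
    fix p assume "p \<in> NCPP n"
    then have "length p = n" and eq: "fst ` set p \<union> snd ` set p = {1..2 * n}"
      by (auto simp: mem_NCPP_iff)
    moreover have "a \<in> {1..2 * n} \<times> {1..2 * n}" if "a \<in> set p" for a
      using that unfolding mem_Times_iff eq[symmetric] by blast
    ultimately show "p \<in> {p. set p \<subseteq> {1..2 * n} \<times> {1..2 * n} \<and> length p = n}" by blast
  qed
qed (simp add: finite_lists_length_eq)

lemma inj_insert_pair: "inj (insert_pair l)"
  unfolding insert_pair_def
  by (rule injI) (simp only: append_same_eq inj_map_eq_map[OF prod.inj_map[OF inj_shift inj_shift]])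

lemma disjoint_union_eq_iff: "A \<inter> B = {} \<Longrightarrow> B \<subseteq> C \<Longrightarrow> A \<union> B = C \<longleftrightarrow> A = C - B"
  by blast

text \<open>Being an order embedding, \<open>shift l\<close> transports each condition on
  \<open>p\<close> in both directions. The appended pair crosses nothing, so its only demand is that
  its left entry be the largest.\<close>

lemma insert_pair_mem_NCPP_iff:
  assumes "1 \<le> l" "l \<le> 2 * n + 1"
  shows "insert_pair l p \<in> NCPP (Suc n) \<longleftrightarrow> p \<in> NCPP n \<and> (\<forall>a\<in>set p. fst a < l)"
proof -
  let ?V = "fst ` set p \<union> snd ` set p"
  have points: "fst ` set (insert_pair l p) \<union> snd ` set (insert_pair l p) =
      shift l ` ?V \<union> {l, l + 1}"
    by (auto simp: insert_pair_def image_Un image_image)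
  have "shift l ` ?V \<inter> {l, l + 1} = {}" using range_shift[of l] by blast
  moreover have "{l, l + 1} \<subseteq> {1..2 * n + 2}" using assms by simp
  ultimately have "shift l ` ?V \<union> {l, l + 1} = {1..2 * n + 2} \<longleftrightarrow>
      shift l ` ?V = {1..2 * n + 2} - {l, l + 1}"
    by (rule disjoint_union_eq_iff)
  also have "\<dots> \<longleftrightarrow> ?V = {1..2 * n}"
    unfolding shift_image_interval[OF assms, symmetric] by (rule inj_image_eq_iff[OF inj_shift])
  finally have cover: "shift l ` ?V \<union> {l, l + 1} = {1..2 * Suc n} \<longleftrightarrow> ?V = {1..2 * n}"
    by simp
  have less: "(\<forall>a\<in>set (insert_pair l p). fst a < snd a) \<longleftrightarrow> (\<forall>a\<in>set p. fst a < snd a)"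
    by (auto simp: insert_pair_def)
  have sorted: "sorted_wrt noncrossing (insert_pair l p) \<longleftrightarrow>
      sorted_wrt noncrossing p \<and> (\<forall>a\<in>set p. fst a < l)"
    by (simp add: insert_pair_def sorted_wrt_append sorted_wrt_map noncrossing_def[abs_def]
        pivot_less_shift_iff)
  have length: "length (insert_pair l p) = Suc n \<longleftrightarrow> length p = n"
    by (simp add: insert_pair_def)
  show ?thesis unfolding mem_NCPP_iff points cover less sorted length by blast
qed

lemma NCPP_append_last:
  assumes "q @ [(l, r)] \<in> NCPP (Suc n)"
  shows "r = l + 1" and "q @ [(l, r)] \<in> range (insert_pair l)"
proof -
  let ?q = "q @ [(l, r)]"
  from assms have len: "length ?q = Suc n"
    and cover: "fst ` set ?q \<union> snd ` set ?q = {1..2 * Suc n}"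
    and "l < r" and sorted: "\<And>a. a \<in> set q \<Longrightarrow> noncrossing a (l, r)"
    by (auto simp: mem_NCPP_iff sorted_wrt_append)
  have "r \<in> {1..2 * Suc n}" unfolding cover[symmetric] by force
  then have "l + 1 \<in> {1..2 * Suc n}" using \<open>l < r\<close> by simp
  then obtain a where a: "a \<in> set ?q" "l + 1 = fst a \<or> l + 1 = snd a"
    unfolding cover[symmetric] by blast
  show r: "r = l + 1"
  proof (cases "a \<in> set q")
    case True
    \<comment> \<open>Left entries of \<open>q\<close> lie below \<open>l\<close>, so
      \<open>l + 1\<close> would be a right entry; then \<open>l < snd a\<close> forces
      \<open>r < snd a = l + 1\<close>, against \<open>l < r\<close>.\<close>
    then show ?thesis using sorted[of a] a \<open>l < r\<close> by (auto simp: noncrossing_def)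
  next
    case False
    then show ?thesis using a by auto
  qed
  \<comment> \<open>The \<open>2 * Suc n\<close> entries cover as many points, so they are distinct;
    hence no entry of \<open>q\<close> is \<open>l\<close> or \<open>l + 1\<close>, and all of them
    have preimages under \<open>shift l\<close>.\<close>
  have "set (map fst ?q @ map snd ?q) = {1..2 * Suc n}"
    using cover by (simp only: set_append set_map)
  moreover have "length (map fst ?q @ map snd ?q) = 2 * Suc n" using len by simp
  ultimately have "distinct (map fst ?q @ map snd ?q)"
    by (intro card_distinct) (simp only: card_atLeastAtMost diff_Suc_1)
  then have "{l, l + 1} \<inter> (fst ` set q \<union> snd ` set q) = {}"
    by (simp add: r Int_Un_distrib)
  then have "fst ` set q \<union> snd ` set q \<subseteq> range (shift l)"
    unfolding range_shift by blast
  then have "set q \<subseteq> range (shift l) \<times> range (shift l)"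
    by (simp only: subset_iff mem_Times_iff Un_iff image_iff) blast
  then have "set q \<subseteq> range (map_prod (shift l) (shift l))"
    by (metis map_prod_surj_on UNIV_Times_UNIV)
  then obtain p where "q = map (map_prod (shift l) (shift l)) p"
    by (metis ex_map_conv subset_iff rangeE)
  then show "?q \<in> range (insert_pair l)"
    by (auto simp: insert_pair_def r)
qed

text \<open>Here \<open>m\<close> is the last left entry minus one:
  \<open>2 * Suc n - Suc m = 2 * n + 1 - m\<close>. Bounding the remaining left entries by
  \<open>m\<close> says that they lie below \<open>Suc m\<close>.\<close>

lemma NCPP_last_eq:
  assumes "m \<le> 2 * n"
  shows "NCPP_last (2 * n + 1 - m) (Suc n) = insert_pair (Suc m) ` NCPP_bounded n m"
proof (intro equalityI subsetI)
  fix q assume q: "q \<in> NCPP_last (2 * n + 1 - m) (Suc n)"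
  then have "q \<in> NCPP (Suc n)" "length q = Suc n" by (auto simp: NCPP_last_def mem_NCPP_iff)
  then obtain q' l r where *: "q = q' @ [(l, r)]" "length q' = n"
    by (metis length_Suc_conv_rev surj_pair)
  \<comment> \<open>By \<open>m \<le> 2 * n\<close> the difference is positive, so the truncated
    subtraction determines \<open>l\<close>.\<close>
  with q assms have "l = Suc m" by (auto simp: NCPP_last_def nth_append)
  then obtain p where "q = insert_pair (Suc m) p"
    using NCPP_append_last(2) * \<open>q \<in> NCPP (Suc n)\<close> by blast
  then show "q \<in> insert_pair (Suc m) ` NCPP_bounded n m"
    using insert_pair_mem_NCPP_iff[of "Suc m" n p] assms \<open>q \<in> NCPP (Suc n)\<close>
    by (auto simp: NCPP_bounded_def less_Suc_eq_le)
next
  fix q assume "q \<in> insert_pair (Suc m) ` NCPP_bounded n m"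
  then obtain p where "q = insert_pair (Suc m) p" "p \<in> NCPP_bounded n m" by blast
  then show "q \<in> NCPP_last (2 * n + 1 - m) (Suc n)"
    using insert_pair_mem_NCPP_iff[of "Suc m" n p] assms
    by (auto simp: NCPP_last_def NCPP_bounded_def less_Suc_eq_le insert_pair_def nth_append
        mem_NCPP_iff)
qed

lemma card_NCPP_last:
  assumes "m \<le> 2 * n"
  shows "card (NCPP_last (2 * n + 1 - m) (Suc n)) = card (NCPP_bounded n m)"
  unfolding NCPP_last_eq[OF assms] by (rule card_image) (rule inj_on_subset[OF inj_insert_pair], simp)

section \<open>Recurrence and closed form for the count with bounded left entries\<close>

lemma NCPP_bounded_Suc_0: "NCPP_bounded (Suc n) 0 = {}"
proof (rule equals0I)
  fix p assume "p \<in> NCPP_bounded (Suc n) 0"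
  then have "length p = Suc n" and cover: "fst ` set p \<union> snd ` set p = {1..2 * Suc n}"
    and zero: "\<forall>a\<in>set p. fst a \<le> 0"
    unfolding NCPP_bounded_def mem_NCPP_iff by blast+
  then have hd: "hd p \<in> set p" by (intro hd_in_set) auto
  then have "fst (hd p) \<in> {1..2 * Suc n}" unfolding cover[symmetric] by blast
  with hd zero show False by force
qed

lemma NCPP_bounded_0: "NCPP_bounded 0 m = {[]}"
  by (auto simp: NCPP_bounded_def mem_NCPP_iff)

lemma NCPP_snoc_bounds:
  assumes "q @ [(l, r)] \<in> NCPP (Suc n)"
  shows "l \<le> 2 * n + 1" and "\<And>a. a \<in> set q \<Longrightarrow> fst a < l"
proof -
  have cover: "fst ` set (q @ [(l, r)]) \<union> snd ` set (q @ [(l, r)]) = {1..2 * Suc n}"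
    using assms unfolding mem_NCPP_iff by blast
  have "r \<in> {1..2 * Suc n}" unfolding cover[symmetric] by force
  then show "l \<le> 2 * n + 1" using NCPP_append_last(1)[OF assms] by simp
  show "\<And>a. a \<in> set q \<Longrightarrow> fst a < l"
    using assms by (auto simp: mem_NCPP_iff sorted_wrt_append noncrossing_def)
qed

text \<open>Left entries increase along the list, so bounding the last one bounds all of
  them.\<close>

lemma mem_NCPP_bounded_iff_last:
  assumes "p \<in> NCPP (Suc n)"
  shows "p \<in> NCPP_bounded (Suc n) m \<longleftrightarrow> fst (p ! n) \<le> m" and "fst (p ! n) \<le> 2 * n + 1"
proof -
  have "length p = Suc n" using assms by (simp add: mem_NCPP_iff)
  then obtain q l r where p: "p = q @ [(l, r)]" and "length q = n"
    by (metis length_Suc_conv_rev surj_pair)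
  then have l: "fst (p ! n) = l" by (simp add: nth_append)
  note bounds = NCPP_snoc_bounds[OF assms[unfolded p]]
  show "fst (p ! n) \<le> 2 * n + 1" unfolding l by (rule bounds(1))
  show "p \<in> NCPP_bounded (Suc n) m \<longleftrightarrow> fst (p ! n) \<le> m"
    unfolding l using assms bounds(2) by (fastforce simp: NCPP_bounded_def p)
qed

text \<open>Case distinction on the last left entry: at most \<open>m\<close>, or equal to
  \<open>Suc m\<close>.\<close>

lemma NCPP_bounded_Suc:
  assumes "m \<le> 2 * n"
  shows "NCPP_bounded (Suc n) (Suc m) =
    NCPP_bounded (Suc n) m \<union> NCPP_last (2 * n + 1 - m) (Suc n)"
    and "NCPP_bounded (Suc n) m \<inter> NCPP_last (2 * n + 1 - m) (Suc n) = {}"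
proof -
  have *: "p \<in> NCPP_last (Suc (2 * n) - m) (Suc n) \<longleftrightarrow> fst (p ! n) = Suc m"
    if "p \<in> NCPP (Suc n)" for p
    using that assms mem_NCPP_bounded_iff_last(2)[OF that] by (auto simp: NCPP_last_def)
  have sub: "NCPP_bounded (Suc n) x \<subseteq> NCPP (Suc n)" "NCPP_last x (Suc n) \<subseteq> NCPP (Suc n)" for x
    by (auto simp: NCPP_bounded_def NCPP_last_def)
  show "NCPP_bounded (Suc n) m \<inter> NCPP_last (2 * n + 1 - m) (Suc n) = {}"
  proof (rule equals0I)
    fix p assume p: "p \<in> NCPP_bounded (Suc n) m \<inter> NCPP_last (2 * n + 1 - m) (Suc n)"
    then have "p \<in> NCPP (Suc n)" using sub by blast
    with p show False by (auto simp: * mem_NCPP_bounded_iff_last(1))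
  qed
  show "NCPP_bounded (Suc n) (Suc m) =
      NCPP_bounded (Suc n) m \<union> NCPP_last (2 * n + 1 - m) (Suc n)"
  proof (rule set_eqI)
    fix p
    show "p \<in> NCPP_bounded (Suc n) (Suc m) \<longleftrightarrow>
        p \<in> NCPP_bounded (Suc n) m \<union> NCPP_last (2 * n + 1 - m) (Suc n)"
    proof (cases "p \<in> NCPP (Suc n)")
      case True
      then show ?thesis by (simp add: * mem_NCPP_bounded_iff_last(1) le_Suc_eq)
    next
      case False
      then show ?thesis using sub by blast
    qed
  qed
qed

text \<open>The greatest point is never a left entry. This supplies the one bound that the
  recurrence, with its condition \<open>m \<le> 2 * n\<close>, does not reach.\<close>

lemma NCPP_bounded_top: "NCPP_bounded (Suc n) (2 * n + 2) = NCPP_bounded (Suc n) (2 * n + 1)"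
proof (rule set_eqI)
  fix p
  show "p \<in> NCPP_bounded (Suc n) (2 * n + 2) \<longleftrightarrow> p \<in> NCPP_bounded (Suc n) (2 * n + 1)"
  proof (cases "p \<in> NCPP (Suc n)")
    case True
    then show ?thesis
      using mem_NCPP_bounded_iff_last(2)[OF True] by (simp add: mem_NCPP_bounded_iff_last(1))
  next
    case False
    then show ?thesis by (simp add: NCPP_bounded_def)
  qed
qed

lemma finite_NCPP_bounded: "finite (NCPP_bounded n m)"
  using finite_NCPP by (simp add: NCPP_bounded_def)

lemma card_NCPP_bounded_Suc:
  assumes "m \<le> 2 * n"
  shows "card (NCPP_bounded (Suc n) (Suc m)) = card (NCPP_bounded (Suc n) m) + card (NCPP_bounded n m)"
  unfolding card_NCPP_last[OF assms, symmetric] NCPP_bounded_Suc(1)[OF assms]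
  using finite_NCPP
  by (intro card_Un_disjoint NCPP_bounded_Suc(2)[OF assms] finite_NCPP_bounded)
    (simp add: NCPP_last_def)

text \<open>A ballot-type count, stated additively to avoid truncated subtraction. The difference of
  binomials obeys the same recurrence by Pascal's rule, and for \<open>Suc n\<close> both sides
  start at zero for \<open>m = 0\<close>.\<close>

lemma card_NCPP_bounded:
  assumes "m \<le> 2 * n"
  shows "card (NCPP_bounded n m) + (m choose Suc n) = m choose n"
  using assms
proof (induction n arbitrary: m)
  case 0
  then show ?case by (simp add: NCPP_bounded_0)
next
  case (Suc n)
  note IH = Suc.IH
  have *: "card (NCPP_bounded (Suc n) m) + (m choose Suc (Suc n)) = m choose Suc n"
    if "m \<le> 2 * n + 1" for m
    using that
  proof (induction m)
    case 0
    then show ?case by (simp add: NCPP_bounded_Suc_0)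
  next
    case (Suc m)
    then show ?case using card_NCPP_bounded_Suc[of m n] IH[of m]
      by simp
  qed
  show ?case
  proof (cases "m \<le> 2 * n + 1")
    case False
    then have m: "m = Suc (2 * n + 1)" using Suc.prems by simp
    \<comment> \<open>Raising \<open>m\<close> from \<open>2 * n + 1\<close> to
      \<open>2 * n + 2\<close> changes the difference of binomials by
      \<open>(2 * n + 1 choose n) - (2 * n + 1 choose Suc n)\<close>, which vanishes by symmetry, in
      line with the unchanged set.\<close>
    have "(2 * n + 1) choose Suc n = (2 * n + 1) choose n"
      using binomial_symmetric[of n "2 * n + 1"] by simp
    then show ?thesis using *[of "2 * n + 1"] NCPP_bounded_top[of n] by (simp add: m)
  qed (rule *)
qed

section \<open>Product formula and comparison with Catalan's triangle\<close>

lemma binomial_diff_ratio: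
  assumes "n \<le> m"
  shows "real (m choose n) - real (m choose Suc n) =
    (2 * real n + 1 - real m) / real (Suc n) * real (m choose n)"
proof -
  have "Suc n * (m choose Suc n) = (m - n) * (m choose n)"
    by (metis binomial_absorb_comp binomial_absorption mult.commute)
  then have "real (Suc n) * real (m choose Suc n) = (real m - real n) * real (m choose n)"
    using assms by (metis of_nat_diff of_nat_mult)
  then show ?thesis by (simp add: field_simps)
qed

theorem theorem2p8:
  fixes n k :: nat
  assumes "n \<ge> 1" and "k \<in> {1..n}"
  shows "real (card (NCPP_last k n)) = catalan_triangle (n - 1) (n - k)
       \<and> catalan_triangle (n - 1) (n - k)
           = real k / real n * real ((2 * n - k - 1) choose (n - 1))"
proof -
  obtain N where n: "n = Suc N" using assms(1) by (cases n) auto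
  \<comment> \<open>With \<open>n = Suc N\<close> the last left entry is
    \<open>2 * n - k = Suc m\<close>. The bound \<open>1 \<le> k\<close> gives
    \<open>m \<le> 2 * N\<close>, and \<open>k \<le> n\<close> gives
    \<open>N \<le> m\<close>.\<close>
  define m where "m = 2 * N + 1 - k"
  have m: "m \<le> 2 * N" "N \<le> m" "k = 2 * N + 1 - m" "2 * n - k - 1 = m"
    "real k = 2 * real N + 1 - real m"
    using assms(2) n by (auto simp: m_def)
  have "card (NCPP_last k n) + (m choose Suc N) = m choose N"
    using card_NCPP_last[OF m(1)] card_NCPP_bounded[OF m(1)] m(3) n by simp
  then have "real (card (NCPP_last k n)) = real (m choose N) - real (m choose Suc N)"
    by linarith
  then have card: "real (card (NCPP_last k n)) = real k / real n * real (m choose N)"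
    unfolding binomial_diff_ratio[OF m(2)] m(5) n .
  have "catalan_triangle (n - 1) (n - k) = real k / real n * real (m choose N)"
  \<comment> \<open>Row \<open>0\<close> of the triangle has its own defining clause; there
    \<open>n = k = 1\<close>.\<close>
  proof (cases "N = 0")
    case True
    then show ?thesis using assms n by (simp add: catalan_triangle_def)
  next
    case False
    \<comment> \<open>The triangle's binomial is \<open>m choose (n - k)\<close>; as
      \<open>n - k = m - N\<close>, symmetry turns it into \<open>m choose N\<close>.\<close>
    have top: "N + (n - k) = m" and "n - k = m - N" using assms(2) n by (auto simp: m_def)
    then have sym: "m choose (n - k) = m choose N" using binomial_symmetric[OF m(2)] by simp
    have k: "real N + 1 - real (n - k) = real k" using assms(2) n by (simp add: of_nat_diff)
    have "n - 1 = N" "real N + 1 = real n" using n by simp_all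
    then show ?thesis using False k
      by (simp only: catalan_triangle_def if_False top sym)
  qed
  with card show ?thesis unfolding m(4) by (simp add: n)
qed

end
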